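(* For all integers $k\ge 2$ and $h\ge 1$, the complete $k$-ary tree $T^{k,h}$ of height $h$ satisfies $$\operatorname{ldc}(T^{k,h})=\begin{cases}5,&\text{if }k=2\text{ and }h=2,\\ 3,&\text{otherwise.}\end{cases}$$
   Context: All graphs are finite, simple and connected; $d(u,v)$ denotes graph distance. For a graph $G$ on $n$ vertices, a labeling is a bijection $c:V(G)\to\{1,\dots,n\}$; write $c(u,v)=|c(u)-c(v)|$. A vertex $u$ is (list-distance) consistent under $c$ if for all $v,w\in V(G)$, $d(u,v)<d(u,w)$ implies $c(u,v)\le c(u,w)$. $S_c(G)$ denotes the set of consistent vertices under $c$, and $\operatorname{ldc}(G)=\max_c|S_c(G)|$ over all labelings $c$ of $G$. For integers $k\ge2$, $h\ge1$, the complete $k$-ary tree of height $h$, $T^{k,h}$, is the rooted tree in which every vertex at distance less than $h$ from the root has exactly $k$ children and every vertex at distance $h$ from the root is a leaf. *)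

theory Defs
  imports "Graph_Theory.Graph_Theory"
begin

text \<open>
  A finite simple graph is a \<^locale>\<open>pair_graph\<close>: a finite loop-free digraph without parallel
  arcs whose arc set is symmetric, so that every undirected edge appears in both directions.
\<close>

context pair_graph
begin

text \<open>Graph distance is the least cost of a walk when every arc has weight one.\<close>

definition gdist :: "'a \<Rightarrow> 'a \<Rightarrow> ereal" where
  "gdist u v = \<mu> (\<lambda>_. 1) u v"

definition labeling :: "('a \<Rightarrow> nat) \<Rightarrow> bool" where
  "labeling c \<longleftrightarrow> bij_betw c (pverts G) {1..card (pverts G)}"

definition label_diff :: "('a \<Rightarrow> nat) \<Rightarrow> 'a \<Rightarrow> 'a \<Rightarrow> int" where
  "label_diff c u v = \<bar>int (c u) - int (c v)\<bar>"

definition consistent :: "('a \<Rightarrow> nat) \<Rightarrow> 'a \<Rightarrow> bool" where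
  "consistent c u \<longleftrightarrow>
    (\<forall>v\<in>pverts G. \<forall>w\<in>pverts G. gdist u v < gdist u w \<longrightarrow> label_diff c u v \<le> label_diff c u w)"

definition consistent_set :: "('a \<Rightarrow> nat) \<Rightarrow> 'a set" where
  "consistent_set c = {u \<in> pverts G. consistent c u}"

definition ldc :: nat where
  "ldc = Max {card (consistent_set c) | c. labeling c}"

text \<open>The maximum in the definition of \<^const>\<open>ldc\<close> is over a finite nonempty set.\<close>

lemma ldc_max_well_defined:
  "finite {card (consistent_set c) | c. labeling c}"
  "{card (consistent_set c) | c. labeling c} \<noteq> {}"
proof -
  have "card (consistent_set c) \<le> card (pverts G)" for c
    by (rule card_mono) (auto simp: consistent_set_def pair_finite_verts)
  then have "{card (consistent_set c) | c. labeling c} \<subseteq> {..card (pverts G)}"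
    by auto
  then show "finite {card (consistent_set c) | c. labeling c}"
    by (rule finite_subset) simp
  have "\<exists>c. labeling c"
    unfolding labeling_def
    by (rule finite_same_card_bij) (auto simp: pair_finite_verts)
  then show "{card (consistent_set c) | c. labeling c} \<noteq> {}"
    by auto
qed

end

text \<open>
  A vertex of the complete \<open>k\<close>-ary tree of height \<open>h\<close> is named by the sequence of child indices on
  the path from the root: the root is \<^term>\<open>[]\<close>, and the children of \<open>xs\<close> are the lists
  \<^term>\<open>xs @ [i]\<close> with \<open>i < k\<close>.
\<close>

definition kary_verts :: "nat \<Rightarrow> nat \<Rightarrow> nat list set" where
  "kary_verts k h = {xs. length xs \<le> h \<and> set xs \<subseteq> {..<k}}"

definition kary_children :: "nat \<Rightarrow> nat \<Rightarrow> nat list \<Rightarrow> nat list set" where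
  "kary_children k h xs = {xs @ [i] | i. xs @ [i] \<in> kary_verts k h}"

definition kary_tree :: "nat \<Rightarrow> nat \<Rightarrow> nat list pair_pre_digraph" where
  "kary_tree k h = \<lparr>
     pverts = kary_verts k h,
     parcs = {(xs, ys). xs \<in> kary_verts k h \<and> ys \<in> kary_verts k h \<and>
                        (ys \<in> kary_children k h xs \<or> xs \<in> kary_children k h ys)} \<rparr>"

lemma pair_graph_kary_tree: "pair_graph (kary_tree k h)"
proof -
  have "finite (kary_verts k h)"
    using finite_lists_length_le[of "{..<k}" h] by (simp add: kary_verts_def conj_commute)
  moreover have "parcs (kary_tree k h) \<subseteq> kary_verts k h \<times> kary_verts k h"
    by (auto simp: kary_tree_def)
  ultimately have "finite (parcs (kary_tree k h))"
    by (meson finite_SigmaI finite_subset)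
  with \<open>finite (kary_verts k h)\<close> show ?thesis
    by unfold_locales
      (auto simp: kary_tree_def kary_children_def symmetric_def sym_def)
qed

lemma card_kary_children:
  assumes "xs \<in> kary_verts k h"
  shows "length xs < h \<Longrightarrow> card (kary_children k h xs) = k"
    and "length xs = h \<Longrightarrow> kary_children k h xs = {}"
proof -
  assume "length xs < h"
  then have "kary_children k h xs = (\<lambda>i. xs @ [i]) ` {..<k}"
    using assms by (auto simp: kary_children_def kary_verts_def)
  then show "card (kary_children k h xs) = k"
    by (simp add: card_image inj_on_def)
qed (auto simp: kary_children_def kary_verts_def)

text \<open>The distance of a vertex from the root is the length of its list.\<close>

lemma gdist_root_kary_tree:
  assumes "xs \<in> kary_verts k h"
  shows "pair_graph.gdist (kary_tree k h) [] xs = ereal (length xs)"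
proof -
  interpret T: pair_graph "kary_tree k h" by (rule pair_graph_kary_tree)
  have cost: "T.awalk_cost (\<lambda>_. 1) p = length p" for p
    by (induction p) auto
  have verts: "pverts (kary_tree k h) = kary_verts k h"
    by (simp add: kary_tree_def)
  have arcs: "(xs, ys) \<in> parcs (kary_tree k h) \<longleftrightarrow>
      xs \<in> kary_verts k h \<and> ys \<in> kary_verts k h \<and>
      (ys \<in> kary_children k h xs \<or> xs \<in> kary_children k h ys)" for xs ys
    by (simp add: kary_tree_def)
  have "\<exists>p. T.awalk [] p xs \<and> length p = length xs"
    using assms
  proof (induction xs rule: rev_induct)
    case Nil
    then show ?case by (auto simp: T.awalk_Nil_iff verts)
  next
    case (snoc i xs)
    then have xs: "xs \<in> kary_verts k h" by (auto simp: kary_verts_def)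
    with snoc obtain p where p: "T.awalk [] p xs" "length p = length xs" by auto
    have "T.awalk xs [(xs, xs @ [i])] (xs @ [i])"
      using snoc.prems xs
      by (auto simp: T.awalk_simps verts arcs kary_children_def)
    with p have "T.awalk [] (p @ [(xs, xs @ [i])]) (xs @ [i])"
      by (blast intro: T.awalk_appendI)
    with p show ?case by (intro exI[of _ "p @ [(xs, xs @ [i])]"]) auto
  qed
  then obtain p where p: "T.awalk [] p xs" "length p = length xs" by blast
  have lower: "length v \<le> length u + length q" if "T.awalk u q v" for u q v
    using that
  proof (induction q arbitrary: u)
    case Nil
    then show ?case by (simp add: T.awalk_Nil_iff)
  next
    case (Cons e q)
    obtain a b where e: "e = (a, b)" by force
    from Cons.prems have "(u, b) \<in> parcs (kary_tree k h)" "T.awalk b q v"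
      by (auto simp: e T.awalk_Cons_iff)
    moreover from this(1) have "length b \<le> Suc (length u)"
      by (auto simp: arcs kary_children_def)
    ultimately show ?case using Cons.IH[of b] by simp
  qed
  show ?thesis
    unfolding T.gdist_def T.\<mu>_def cost
  proof (rule antisym)
    show "(INF q\<in>{q. T.awalk [] q xs}. ereal (length q)) \<le> ereal (length xs)"
      using p by (auto intro!: INF_lower2[of p])
    show "ereal (length xs) \<le> (INF q\<in>{q. T.awalk [] q xs}. ereal (length q))"
      using lower[of "[]"] by (auto intro!: INF_greatest)
  qed
qed

end

theory Submission
  imports Defs
begin

text \<open>
  Every ball around a consistent vertex occupies an interval of labels. Let \<open>w\<close> be the deepest
  vertex whose subtree contains all consistent vertices, and let \<open>u\<close> be a consistent vertex in the
  branch of a child \<open>a\<close> of \<open>w\<close>. Unless the subtree is tiny, the large balls around \<open>u\<close> are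
  the branch of \<open>a\<close> together with a ball around \<open>w\<close>. If consistent vertices lie in two
  branches, these intervals force any vertex at the right distance from \<open>w\<close> outside both branches
  onto both sides of \<open>w\<close>; such a vertex is missing only if \<open>w\<close> is the root and \<open>k = 2\<close>. If
  instead \<open>w\<close> itself is consistent, its balls are balanced around its label up to one label, which
  contradicts the size of the branches other than \<open>a\<close> unless \<open>k = 2\<close>. In the surviving binary
  cases the labels of the branch of \<open>a\<close> are sorted by decreasing depth near the leaves, and then
  only the child of \<open>w\<close> itself can be consistent.
\<close>

subsection \<open>Distance in the tree\<close>

text \<open>Path length through the lowest common ancestor, in a recursive form that avoids walks
  and can be evaluated on concrete vertices.\<close>

fun tdist :: "nat list \<Rightarrow> nat list \<Rightarrow> nat" where
  "tdist [] ys = length ys"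
| "tdist xs [] = length xs"
| "tdist (x # xs) (y # ys) = (if x = y then tdist xs ys else length xs + length ys + 2)"

lemma tdist_Nil2 [simp]: "tdist xs [] = length xs"
  by (cases xs) auto

lemma tdist_append_same [simp]: "tdist (w @ xs) (w @ ys) = tdist xs ys"
  by (induction w) auto

lemma tdist_same [simp]: "tdist xs xs = 0"
  by (induction xs) auto

lemma tdist_prefix [simp]: "tdist w (w @ ys) = length ys" "tdist (w @ ys) w = length ys"
  by (induction w) auto

lemma tdist_le: "tdist xs ys \<le> length xs + length ys"
  by (induction xs ys rule: tdist.induct) auto

lemma tdist_commute: "tdist xs ys = tdist ys xs"
  by (induction xs ys rule: tdist.induct) auto

lemma tdist_eq_0: "tdist xs ys = 0 \<longleftrightarrow> xs = ys"
  by (induction xs ys rule: tdist.induct) auto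

text \<open>A path leaving the subtree of \<open>w @ [a]\<close> must pass through \<open>w\<close>,
  so the two legs add up.\<close>

lemma tdist_off_branch:
  assumes "\<nexists>y. x = w @ a # y"
  shows "tdist (w @ a # u) x = Suc (length u) + tdist w x"
  using assms
proof (induction w arbitrary: x)
  case Nil
  then show ?case by (cases x) auto
next
  case (Cons b w)
  then show ?case by (cases x) auto
qed

text \<open>The one-arc case of the triangle inequality, from which walks in the tree get their
  lower bound.\<close>

lemma tdist_snoc: "tdist xs (ys @ [i]) \<le> Suc (tdist xs ys)" "tdist xs ys \<le> Suc (tdist xs (ys @ [i]))"
  by (induction xs ys rule: tdist.induct) (auto split: list.split)

lemma common_prefix_decomp:
  obtains p x y where "xs = p @ x" "ys = p @ y" "tdist xs ys = length x + length y"
proof (induction xs ys arbitrary: thesis rule: tdist.induct)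
  case (1 ys)
  then show ?case by (metis append_Nil list.size(3) plus_nat.add_0 tdist.simps(1))
next
  case (2 v va)
  then show ?case by (metis append_Nil list.size(3) add.right_neutral tdist_Nil2)
next
  case (3 x xs y ys)
  show ?case
  proof (cases "x = y")
    case True
    obtain p a b where "xs = p @ a" "ys = p @ b" "tdist xs ys = length a + length b"
      using "3.IH"[OF True] by blast
    then show ?thesis using True by (intro "3.prems"[of "x # p" a b]) auto
  next
    case False
    then show ?thesis by (intro "3.prems"[of "[]" "x # xs" "y # ys"]) auto
  qed
qed

lemma kary_verts_append: "xs @ ys \<in> kary_verts k h \<Longrightarrow> xs \<in> kary_verts k h"
  by (auto simp: kary_verts_def)

lemma finite_kary_verts: "finite (kary_verts k h)"
  using finite_lists_length_le[of "{..<k}" h] by (simp add: kary_verts_def conj_commute)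

text \<open>Climbing to the common prefix and descending again realizes \<open>tdist u v\<close>. No
  walk is shorter, because each arc lowers the distance to \<open>v\<close> by at most one.\<close>

lemma gdist_kary_tree:
  assumes "u \<in> kary_verts k h" "v \<in> kary_verts k h"
  shows "pair_graph.gdist (kary_tree k h) u v = ereal (tdist u v)"
proof -
  interpret T: pair_graph "kary_tree k h" by (rule pair_graph_kary_tree)
  have cost: "T.awalk_cost (\<lambda>_. 1) p = length p" for p
    by (induction p) auto
  have verts: "pverts (kary_tree k h) = kary_verts k h"
    by (simp add: kary_tree_def)
  have arcs: "(xs, ys) \<in> parcs (kary_tree k h) \<longleftrightarrow>
      xs \<in> kary_verts k h \<and> ys \<in> kary_verts k h \<and>
      (ys \<in> kary_children k h xs \<or> xs \<in> kary_children k h ys)" for xs ys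
    by (simp add: kary_tree_def)
  have down: "\<exists>q. T.awalk p q (p @ x) \<and> length q = length x" if "p @ x \<in> kary_verts k h" for p x
    using that
  proof (induction x rule: rev_induct)
    case Nil
    then show ?case by (auto simp: T.awalk_Nil_iff verts)
  next
    case (snoc i x)
    then have x: "p @ x \<in> kary_verts k h" using kary_verts_append[of "p @ x"] by simp
    with snoc obtain q where q: "T.awalk p q (p @ x)" "length q = length x" by auto
    have "T.awalk (p @ x) [(p @ x, p @ x @ [i])] (p @ x @ [i])"
      using snoc.prems x by (auto simp: T.awalk_simps verts arcs kary_children_def)
    with q have "T.awalk p (q @ [(p @ x, p @ x @ [i])]) (p @ x @ [i])"
      by (blast intro: T.awalk_appendI)
    with q show ?case by (intro exI[of _ "q @ [(p @ x, p @ x @ [i])]"]) auto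
  qed
  have up: "\<exists>q. T.awalk (p @ x) q p \<and> length q = length x" if "p @ x \<in> kary_verts k h" for p x
    using that
  proof (induction x rule: rev_induct)
    case Nil
    then show ?case by (auto simp: T.awalk_Nil_iff verts)
  next
    case (snoc i x)
    then have x: "p @ x \<in> kary_verts k h" using kary_verts_append[of "p @ x"] by simp
    with snoc obtain q where q: "T.awalk (p @ x) q p" "length q = length x" by auto
    have "T.awalk (p @ x @ [i]) ((p @ x @ [i], p @ x) # q) p"
      using snoc.prems x q by (auto simp: T.awalk_Cons_iff arcs kary_children_def)
    with q show ?case by (intro exI[of _ "(p @ x @ [i], p @ x) # q"]) auto
  qed
  obtain p x y where d: "u = p @ x" "v = p @ y" "tdist u v = length x + length y"
    by (rule common_prefix_decomp)
  obtain q1 q2 where q: "T.awalk u q1 p" "length q1 = length x" "T.awalk p q2 v" "length q2 = length y"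
    using up down d assms by meson
  then have w: "T.awalk u (q1 @ q2) v" "length (q1 @ q2) = tdist u v"
    using d by (auto intro: T.awalk_appendI)
  have lower: "tdist a v \<le> length q" if "T.awalk a q v" for a q
    using that
  proof (induction q arbitrary: a)
    case Nil
    then show ?case by (simp add: T.awalk_Nil_iff)
  next
    case (Cons e q)
    obtain a' b where e: "e = (a', b)" by force
    from Cons.prems have ab: "(a, b) \<in> parcs (kary_tree k h)" "T.awalk b q v"
      by (auto simp: e T.awalk_Cons_iff)
    from ab(1) have "tdist a v \<le> Suc (tdist b v)"
      using tdist_snoc[of v] by (auto simp: arcs kary_children_def tdist_commute)
    then show ?case using Cons.IH[of b] ab by simp
  qed
  show ?thesis
    unfolding T.gdist_def T.\<mu>_def cost
  proof (rule antisym)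
    show "(INF q\<in>{q. T.awalk u q v}. ereal (length q)) \<le> ereal (tdist u v)"
      using w by (auto intro!: INF_lower2[of "q1 @ q2"])
    show "ereal (tdist u v) \<le> (INF q\<in>{q. T.awalk u q v}. ereal (length q))"
      using lower[of u] by (auto intro!: INF_greatest)
  qed
qed

subsection \<open>Balls around consistent vertices\<close>

locale kary =
  fixes k h :: nat
  assumes k2: "k \<ge> 2" and h1: "h \<ge> 1"
begin

abbreviation V :: "nat list set" where "V \<equiv> kary_verts k h"

definition lab :: "(nat list \<Rightarrow> int) \<Rightarrow> bool" where
  "lab c \<longleftrightarrow> inj_on c V \<and> (\<exists>lo hi. c ` V = {lo..hi})"

definition cons :: "(nat list \<Rightarrow> int) \<Rightarrow> nat list \<Rightarrow> bool" where
  "cons c u \<longleftrightarrow> u \<in> V \<and>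
    (\<forall>x\<in>V. \<forall>y\<in>V. tdist u x < tdist u y \<longrightarrow> \<bar>c u - c x\<bar> \<le> \<bar>c u - c y\<bar>)"

definition tball :: "nat list \<Rightarrow> nat \<Rightarrow> nat list set" where
  "tball u r = {x \<in> V. tdist u x \<le> r}"

definition branch :: "nat list \<Rightarrow> nat \<Rightarrow> nat list set" where
  "branch w a = {x \<in> V. \<exists>y. x = w @ a # y}"

text \<open>Order convexity in the order that \<open>c\<close> induces on \<open>V\<close>. If
  \<open>lab c\<close> holds and \<open>A\<close> lies in \<open>V\<close>, it says that
  \<open>A\<close> occupies a block of consecutive labels.\<close>

definition cvx :: "(nat list \<Rightarrow> int) \<Rightarrow> nat list set \<Rightarrow> bool" where
  "cvx c A \<longleftrightarrow> (\<forall>x\<in>A. \<forall>y\<in>A. \<forall>z\<in>V. c x < c z \<longrightarrow> c z < c y \<longrightarrow> z \<in> A)"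

lemma lab_uminus: "lab c \<Longrightarrow> lab (\<lambda>x. - c x)"
proof -
  assume l: "lab c"
  then obtain lo hi where "c ` V = {lo..hi}" by (auto simp: lab_def)
  moreover have "(\<lambda>x. - c x) ` V = uminus ` (c ` V)" by (simp add: image_image)
  ultimately have "(\<lambda>x. - c x) ` V = {-hi..-lo}" by simp
  with l show ?thesis by (auto simp: lab_def inj_on_def)
qed

lemma cons_uminus: "cons (\<lambda>x. - c x) u \<longleftrightarrow> cons c u"
  by (simp add: cons_def abs_minus_commute)

lemma cvx_uminus: "cvx (\<lambda>x. - c x) A \<longleftrightarrow> cvx c A"
  by (auto simp: cvx_def)

lemma cvxD: "cvx c A \<Longrightarrow> x \<in> A \<Longrightarrow> y \<in> A \<Longrightarrow> z \<in> V \<Longrightarrow> c x < c z \<Longrightarrow> c z < c y \<Longrightarrow> z \<in> A"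
  unfolding cvx_def by blast

lemma tball_subset: "tball u r \<subseteq> V" by (auto simp: tball_def)

lemma branch_subset: "branch w a \<subseteq> V" by (auto simp: branch_def)

lemma finite_tball: "finite (tball u r)"
  using finite_subset[OF tball_subset finite_kary_verts] .

text \<open>A label strictly between two others is closer to \<open>c u\<close> than one of them,
  whereas a vertex outside the ball is farther from \<open>u\<close> than both.\<close>

lemma tball_cvx:
  assumes "cons c u"
  shows "cvx c (tball u r)"
  unfolding cvx_def
proof (intro ballI impI)
  fix x y z assume x: "x \<in> tball u r" and y: "y \<in> tball u r" and z: "z \<in> V"
    and l: "c x < c z" "c z < c y"
  show "z \<in> tball u r"
  proof (rule ccontr)
    assume "z \<notin> tball u r"
    then have "tdist u x < tdist u z" "tdist u y < tdist u z" using x y z by (auto simp: tball_def)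
    then have "\<bar>c u - c x\<bar> \<le> \<bar>c u - c z\<bar>" "\<bar>c u - c y\<bar> \<le> \<bar>c u - c z\<bar>"
      using assms x y z by (auto simp: cons_def tball_def)
    then show False using l by linarith
  qed
qed

text \<open>The bound on \<open>h\<close> puts the deepest vertices of the branch within
  \<open>Suc R\<close> of \<open>w @ [a]\<close>, so the ball swallows the whole branch. Elsewhere
  all distances from \<open>u\<close> exceed those from \<open>w\<close> by the same amount.\<close>

lemma branch_tball:
  assumes u: "u = w @ a # u'" "u \<in> V" and R: "h \<le> length w + 2 + R"
  shows "tball u (Suc (length u') + R) = branch w a \<union> tball w R"
proof (rule set_eqI)
  fix x
  show "x \<in> tball u (Suc (length u') + R) \<longleftrightarrow> x \<in> branch w a \<union> tball w R"
  proof (cases "x \<in> branch w a")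
    case True
    then obtain y where y: "x = w @ a # y" "x \<in> V" by (auto simp: branch_def)
    then have "length y \<le> Suc R" using R by (auto simp: kary_verts_def)
    moreover have "tdist u x \<le> length u' + length y"
      using tdist_le[of u' y] by (simp add: u y)
    ultimately show ?thesis using True y by (auto simp: tball_def)
  next
    case False
    show ?thesis
    proof (cases "x \<in> V")
      case True
      then have "\<nexists>y. x = w @ a # y" using False by (auto simp: branch_def)
      from tdist_off_branch[OF this] show ?thesis using False True u by (auto simp: tball_def)
    qed (auto simp: tball_def branch_def)
  qed
qed

lemma branch_cvx:
  assumes "cons c u" "u \<in> branch w a" "h \<le> length w + 2 + R"
  shows "cvx c (branch w a \<union> tball w R)"
proof -
  obtain u' where "u = w @ a # u'" "u \<in> V" using assms by (auto simp: branch_def)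
  from branch_tball[OF this assms(3)] tball_cvx[OF assms(1)] show ?thesis by metis
qed

text \<open>Let \<open>m\<close> have the least label above \<open>c u\<close> outside the ball.
  Labels have no gaps, so the ball fills everything between \<open>c u\<close> and
  \<open>c m\<close>. By consistency its labels to the left reach no farther from \<open>c u\<close>
  than \<open>c m\<close> does.\<close>

lemma balance:
  assumes l: "lab c" and u: "cons c u" and z: "z \<in> V" "z \<notin> tball u r" "c u < c z"
  shows "card {x \<in> tball u r. c x < c u} \<le> Suc (card {x \<in> tball u r. c u < c x})"
proof -
  let ?Z = "{z \<in> V - tball u r. c u < c z}"
  have inj: "inj_on c V" using l by (simp add: lab_def)
  have "finite ?Z" "?Z \<noteq> {}" using z finite_kary_verts by auto
  then obtain m where m: "m \<in> ?Z" "\<And>y. y \<in> ?Z \<Longrightarrow> c m \<le> c y"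
    using ex_is_arg_min_if_finite[of ?Z c] by (auto simp: is_arg_min_linorder)
  have sub: "{c u<..<c m} \<subseteq> c ` {x \<in> tball u r. c u < c x}"
  proof
    fix t assume t: "t \<in> {c u<..<c m}"
    obtain lo hi where "c ` V = {lo..hi}" using l by (auto simp: lab_def)
    moreover have "c u \<in> c ` V" "c m \<in> c ` V" using u m by (auto simp: cons_def)
    ultimately have "t \<in> c ` V" using t by auto
    then obtain x where x: "x \<in> V" "t = c x" by auto
    then have "x \<in> tball u r" using m(2)[of x] t by fastforce
    then show "t \<in> c ` {x \<in> tball u r. c u < c x}" using x t by auto
  qed
  have fin: "finite {x \<in> tball u r. c u < c x}" "finite {x \<in> tball u r. c x < c u}"
    using finite_tball by auto
  have 1: "nat (c m - c u - 1) \<le> card {x \<in> tball u r. c u < c x}"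
  proof -
    have "card {c u<..<c m} \<le> card (c ` {x \<in> tball u r. c u < c x})"
      using sub fin by (intro card_mono) auto
    also have "\<dots> \<le> card {x \<in> tball u r. c u < c x}" using fin by (intro card_image_le)
    finally show ?thesis by simp
  qed
  have 2: "card {x \<in> tball u r. c x < c u} \<le> nat (c m - c u)"
  proof -
    \<comment> \<open>The lower end is the reflection of \<open>c m\<close> in
      \<open>c u\<close>.\<close>
    have "c ` {x \<in> tball u r. c x < c u} \<subseteq> {2 * c u - c m..<c u}"
    proof
      fix t assume "t \<in> c ` {x \<in> tball u r. c x < c u}"
      then obtain x where x: "x \<in> tball u r" "t = c x" "c x < c u" by auto
      then have "tdist u x < tdist u m" using m by (auto simp: tball_def)
      then have "\<bar>c u - c x\<bar> \<le> \<bar>c u - c m\<bar>"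
        using u x m(1) unfolding cons_def tball_def by blast
      moreover have "c u < c m" using m by blast
      ultimately have "c u - c x \<le> c m - c u" by linarith
      then show "t \<in> {2 * c u - c m..<c u}" using x by auto
    qed
    then have "card (c ` {x \<in> tball u r. c x < c u}) \<le> card {2 * c u - c m..<c u}"
      by (intro card_mono) auto
    moreover have "card (c ` {x \<in> tball u r. c x < c u}) = card {x \<in> tball u r. c x < c u}"
      using inj tball_subset by (intro card_image) (auto intro: inj_on_subset)
    ultimately show ?thesis by (simp add: algebra_simps)
  qed
  show ?thesis using 1 2 m(1) by simp
qed

subsection \<open>Consistent vertices in two branches\<close>

text \<open>
  In the hypothesis \<open>h = length w + 2 + R\<close> the subtree below \<open>w\<close> has height \<open>R + 2\<close>, so within
  it the balls of radius \<open>Suc R\<close> and \<open>R\<close> around \<open>w\<close> omit the last level and the last two levels.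
\<close>

lemma append_in_V: "w @ a # ys \<in> V \<longleftrightarrow> w \<in> V \<and> a < k \<and> set ys \<subseteq> {..<k} \<and> length w + length ys < h"
  by (auto simp: kary_verts_def)

lemma set_replicate_0 [simp]: "set (replicate n 0) \<subseteq> {..<k}"
  using k2 by auto

lemma other_child: "\<exists>b<k. b \<noteq> a"
  using k2 by (metis less_le_trans pos2 one_less_numeral_iff semiring_norm(76) zero_neq_one)

lemma third_child:
  assumes "3 \<le> k"
  shows "\<exists>d<k. d \<noteq> a \<and> d \<noteq> b"
proof -
  have "card ({..<k} - {a, b}) \<ge> k - card {a, b}" by (metis card_lessThan diff_card_le_card_Diff finite.emptyI finite.insertI)
  moreover have "card {a, b} \<le> 2" by (simp add: card_insert_if)
  ultimately have "{..<k} - {a, b} \<noteq> {}" using assms by (metis card.empty diff_is_0_eq le_trans not_less_eq_eq numeral_2_eq_2 numeral_3_eq_3 le_zero_eq)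
  then show ?thesis by auto
qed

lemma self_in_tball: "w \<in> V \<Longrightarrow> w \<in> tball w R"
  by (simp add: tball_def)

lemma branch_disjoint: "a \<noteq> b \<Longrightarrow> x \<in> branch w a \<Longrightarrow> x \<notin> branch w b"
  by (auto simp: branch_def)

lemma branch_child_less: "u \<in> branch w a \<Longrightarrow> a < k \<and> w \<in> V"
  by (auto simp: branch_def append_in_V)

lemma branch_leaf:
  assumes "w \<in> V" "a < k" "h = length w + 2 + R"
  shows "w @ a # replicate (Suc R) 0 \<in> branch w a - tball w (Suc R)"
proof -
  have "length w + Suc R < h" using assms by simp
  then show ?thesis
    using assms(1,2) set_replicate_0[of "Suc R"]
    by (auto simp: branch_def tball_def append_in_V simp del: replicate_Suc)
qed

text \<open>The vertex lies in a third branch if there is one. Otherwise it is reached through the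
  parent of \<open>w\<close>, either the parent itself or a vertex below another child of
  it.\<close>

lemma far_vertex:
  assumes w: "w \<in> V" and hR: "h = length w + 2 + R" and kw: "3 \<le> k \<or> w \<noteq> []"
  shows "\<exists>z\<in>tball w (Suc R). z \<notin> tball w R \<and> z \<notin> branch w a \<and> z \<notin> branch w b"
proof -
  have hR': "length w + R < h" using hR by simp
  show ?thesis using kw
  proof
    assume "3 \<le> k"
    then obtain d where d: "d < k" "d \<noteq> a" "d \<noteq> b" using third_child by blast
    show ?thesis
      by (rule bexI[of _ "w @ d # replicate R 0"])
        (use d w hR' set_replicate_0 in \<open>auto simp: tball_def branch_def append_in_V\<close>)
  next
    assume "w \<noteq> []"
    then obtain w0 d where w0: "w = w0 @ [d]" by (metis rev_exhaust)
    obtain d' where d': "d' < k" "d' \<noteq> d" using other_child by blast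
    show ?thesis
    proof (cases R)
      case 0
      show ?thesis
        by (rule bexI[of _ w0]) (use w w0 0 in \<open>auto simp: tball_def branch_def append_in_V\<close>)
    next
      case (Suc r)
      show ?thesis
        by (rule bexI[of _ "w0 @ d' # replicate r 0"])
          (use w w0 Suc d' hR' set_replicate_0 in \<open>auto simp: tball_def branch_def append_in_V\<close>)
    qed
  qed
qed

text \<open>If \<open>x\<close> and \<open>y\<close> were on the same side of some \<open>n\<close>
  in \<open>M\<close>, the middle one of the three would violate the convexity of a set that omits
  it. So every \<open>n\<close> lies between \<open>x\<close> and \<open>y\<close>, and the order of
  \<open>x\<close> and \<open>y\<close> is the same for all \<open>n\<close>.\<close>

lemma sides:
  assumes inj: "inj_on c V" and cvx: "cvx c (A \<union> M)" "cvx c (B \<union> M)" and V: "A \<subseteq> V" "B \<subseteq> V" "M \<subseteq> V"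
    and x: "x \<in> A" "x \<notin> B" "x \<notin> M" and y: "y \<in> B" "y \<notin> A" "y \<notin> M"
    and m: "m \<in> M" "m' \<in> M" "c x < c m"
  shows "c m' < c y" "c x < c m'"
proof -
  have ne: "c x \<noteq> c y" "c x \<noteq> c n" "c y \<noteq> c n" if "n \<in> M" for n
    using inj_onD[OF inj, of x y] inj_onD[OF inj, of x n] inj_onD[OF inj, of y n] V x y that by blast+
  have 1: "c n < c y" if "n \<in> M" "c x < c n" for n
  proof (rule ccontr)
    assume "\<not> c n < c y"
    then have "c y < c n" using ne[OF that(1)] by linarith
    then show False
      using cvxD[OF cvx(1), of x n y] cvxD[OF cvx(2), of y n x] that x y V ne by fastforce
  qed
  have 2: "c y < c n" if "n \<in> M" "c n < c x" for n
  proof (rule ccontr)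
    assume "\<not> c y < c n"
    then have "c n < c y" using ne[OF that(1)] by linarith
    then show False
      using cvxD[OF cvx(1), of n x y] cvxD[OF cvx(2), of n y x] that x y V ne by fastforce
  qed
  show "c x < c m'" using 1[of m] 2[of m'] m ne[of m'] by fastforce
  then show "c m' < c y" using 1 m by blast
qed

lemma beyond:
  assumes "inj_on c V" "cvx c A" "A \<subseteq> V" "x \<in> A" "c x < c z" "z \<in> V" "z \<notin> A" "y \<in> A"
  shows "c y < c z"
  using cvxD[of c A x y z] inj_onD[of c V y z] assms by (metis linorder_neqE_linordered_idom subsetD)

text \<open>The larger ball around \<open>w\<close> lies between the leaves \<open>la\<close> and
  \<open>lb\<close>. The vertex \<open>z\<close> is in it but avoids both branches and the smaller
  ball, so the convex set containing \<open>la\<close> and \<open>w\<close> lies below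
  \<open>z\<close>, while the one containing \<open>lb\<close> and \<open>w\<close> lies above
  it.\<close>

lemma two_branches_contra_aux:
  assumes lab: "lab c" and u: "cons c u" "u \<in> branch w a" and v: "cons c v" "v \<in> branch w b"
    and ab: "a \<noteq> b" and hR: "h = length w + 2 + R" and kw: "3 \<le> k \<or> w \<noteq> []"
    and lt: "c (w @ a # replicate (Suc R) 0) < c w"
  shows False
proof -
  have inj: "inj_on c V" using lab by (simp add: lab_def)
  have w: "w \<in> V" "a < k" "b < k" using branch_child_less u v by auto
  obtain z where z: "z \<in> tball w (Suc R)" "z \<notin> tball w R" "z \<notin> branch w a" "z \<notin> branch w b"
    using far_vertex[OF w(1) hR kw] by blast
  define la lb where "la = w @ a # replicate (Suc R) 0" and "lb = w @ b # replicate (Suc R) 0"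
  have la: "la \<in> branch w a" "la \<notin> tball w (Suc R)" "la \<notin> branch w b"
    and lb: "lb \<in> branch w b" "lb \<notin> tball w (Suc R)" "lb \<notin> branch w a"
    using branch_leaf[OF w(1,2) hR] branch_leaf[OF w(1,3) hR] branch_disjoint ab
    unfolding la_def lb_def by blast+
  have c1: "cvx c (branch w a \<union> tball w (Suc R))" "cvx c (branch w b \<union> tball w (Suc R))"
    and c2: "cvx c (branch w a \<union> tball w R)" "cvx c (branch w b \<union> tball w R)"
    using branch_cvx u v hR by auto
  have s: "c z < c lb" "c la < c z"
    using sides[OF inj c1 branch_subset branch_subset tball_subset la(1,3,2) lb(1,3,2) self_in_tball[OF w(1)] z(1)]
      lt unfolding la_def by auto
  have "c w < c z"
    using beyond[OF inj c2(1) _ _ s(2), of w] la z self_in_tball[OF w(1)] branch_subset tball_subset by blast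
  \<comment> \<open>The mirror image of the previous step, with \<open>lb\<close> in place of
    \<open>la\<close>.\<close>
  moreover have "- c w < - c z"
    using beyond[of "\<lambda>x. - c x", OF _ _ _ _ , of "branch w b \<union> tball w R" lb z w] s inj c2(2)
      lb z self_in_tball[OF w(1)] branch_subset[of w b] tball_subset[of w R] tball_subset[of w "Suc R"]
    by (auto simp: cvx_uminus inj_on_def)
  ultimately show False by linarith
qed

lemma leaf_label_neq:
  assumes "lab c" "w \<in> V" "a < k" "h = length w + 2 + R"
  shows "c (w @ a # replicate (Suc R) 0) \<noteq> c w"
  using branch_leaf[OF assms(2-4)] inj_onD[of c V _ w] assms(1,2) by (auto simp: lab_def branch_def)

lemma two_branches_contra:
  assumes "lab c" "cons c u" "u \<in> branch w a" "cons c v" "v \<in> branch w b"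
    "a \<noteq> b" "h = length w + 2 + R" "3 \<le> k \<or> w \<noteq> []"
  shows False
proof (cases "c (w @ a # replicate (Suc R) 0) < c w")
  case True
  with two_branches_contra_aux assms show ?thesis by blast
next
  case False
  then have "- c (w @ a # replicate (Suc R) 0) < - c w"
    using leaf_label_neq[OF assms(1) _ _ assms(7)] branch_child_less[OF assms(3)] by force
  then show ?thesis
    using two_branches_contra_aux[OF lab_uminus[OF assms(1)] iffD2[OF cons_uminus assms(2)] assms(3)
        iffD2[OF cons_uminus assms(4)] assms(5-8)] by blast
qed

section \<open>The binary case: branches sorted by depth near the leaves\<close>

text \<open>The hypotheses sort the labels as last level of the branch, then last but one, then
  inner ball. A consistent \<open>u\<close> below \<open>w @ [a]\<close> has a small ball that meets
  the two outer groups but misses a vertex of the middle one, against convexity.\<close>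

lemma end_of_branch:
  assumes u: "cons c u" "u \<in> branch w a" and hr: "h = length w + 3 + r"
    and 1: "\<And>x y. x \<in> branch w a - tball w (Suc (Suc r)) \<Longrightarrow>
       y \<in> branch w a \<inter> tball w (Suc (Suc r)) - tball w (Suc r) \<Longrightarrow> c x < c y"
    and 2: "\<And>y m. y \<in> branch w a \<inter> tball w (Suc (Suc r)) - tball w (Suc r) \<Longrightarrow>
       m \<in> tball w (Suc r) \<Longrightarrow> c y < c m"
  shows "u = w @ [a]"
proof (rule ccontr)
  obtain u' where u': "u = w @ a # u'" "u \<in> V" using u by (auto simp: branch_def)
  assume "u \<noteq> w @ [a]"
  then obtain d u'' where d: "u' = d # u''" using u' by (cases u') auto
  obtain d' where d': "d' < k" "d' \<noteq> d" using other_child by blast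
  have wk: "w \<in> V" "a < k" "set u' \<subseteq> {..<k}" "length w + length u' < h"
    using u' by (auto simp: append_in_V)
  have hr': "Suc (Suc (length w + r)) < h" "length w + length u' + (Suc (Suc r) - length u') < h"
    using hr wk by auto
  \<comment> \<open>This vertex of the middle group lies below a child of \<open>w @ [a]\<close>
    whose subtree does not contain \<open>u\<close>, so it is far from \<open>u\<close>.\<close>
  define x where "x = w @ a # d' # replicate r 0"
  have x: "x \<in> branch w a \<inter> tball w (Suc (Suc r)) - tball w (Suc r)"
    using wk d' hr' set_replicate_0 by (auto simp: x_def branch_def tball_def append_in_V)
  have ux: "tdist u x = length u' + Suc r" using d' by (simp add: u' x_def d)
  have no: False if l: "l \<in> branch w a - tball w (Suc (Suc r))" "tdist u l \<le> s"
    and m: "m \<in> tball w (Suc r)" "tdist u m \<le> s" and s: "s < tdist u x" for l m s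
  proof -
    have "l \<in> tball u s" "m \<in> tball u s" "x \<in> V" "x \<notin> tball u s"
      using l m s x by (auto simp: tball_def branch_def)
    then show False using cvxD[OF tball_cvx[OF u(1), of s], of l m x] 1[OF l(1) x] 2[OF x m(1)] by blast
  qed
  have tk: "w @ a # take n u' \<in> V" for n
    using wk set_take_subset[of n u'] by (auto simp: append_in_V)
  have tu: "tdist u (w @ a # take n u') = length u' - n" for n
  proof -
    have "tdist (w @ a # take n u' @ drop n u') (w @ a # take n u') = length (drop n u')"
      by (metis append.assoc append_Cons tdist_prefix(2))
    then show ?thesis using u' by simp
  qed
  show False
  proof (cases "length u' \<le> Suc r")
    case True
    \<comment> \<open>The two witnesses near \<open>u\<close> are a deepest descendant and the
      parent of \<open>u\<close>.\<close>
    let ?l = "u @ replicate (Suc (Suc r) - length u') 0"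
    show False
    proof (rule no)
      show "?l \<in> branch w a - tball w (Suc (Suc r))"
        using True wk hr' set_replicate_0 by (auto simp: u' branch_def tball_def append_in_V)
      show "tdist u ?l \<le> Suc (Suc r) - length u'" by simp
      show "w @ a # take (length u' - 1) u' \<in> tball w (Suc r)"
        using tk True by (auto simp: tball_def)
      show "tdist u (w @ a # take (length u' - 1) u') \<le> Suc (Suc r) - length u'"
        unfolding tu using True d by auto
      show "Suc (Suc r) - length u' < tdist u x" unfolding ux using d True by simp
    qed
  next
    case False
    \<comment> \<open>Here \<open>u\<close> is itself on the last level; it is paired with its
      grandparent.\<close>
    then have l: "length u' = Suc (Suc r)" using wk hr by simp
    show False
    proof (rule no)
      show "u \<in> branch w a - tball w (Suc (Suc r))" using u' l by (auto simp: branch_def tball_def)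
      show "tdist u u \<le> 2" by simp
      show "w @ a # take r u' \<in> tball w (Suc r)" using tk by (auto simp: tball_def)
      show "tdist u (w @ a # take r u') \<le> 2" unfolding tu using l by simp
      show "2 < tdist u x" using l ux by simp
    qed
  qed
qed

text \<open>Convexity with the other branch supplies the sorting that \<open>end_of_branch\<close>
  requires: \<open>sides\<close> puts the last level of the branch of \<open>a\<close> below the
  larger ball, and \<open>beyond\<close>, mirrored, puts the next level below the smaller
  ball.\<close>

lemma two_branches_top_aux:
  assumes lab: "lab c" and u: "cons c u" "u \<in> branch w a" and v: "cons c v" "v \<in> branch w b"
    and ab: "a \<noteq> b" and hr: "h = length w + 3 + r"
    and lt: "c (w @ a # replicate (Suc (Suc r)) 0) < c w"
  shows "u = w @ [a]"
proof -
  let ?R = "Suc r"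
  have hR: "h = length w + 2 + ?R" using hr by simp
  have inj: "inj_on c V" using lab by (simp add: lab_def)
  have inj': "inj_on (\<lambda>x. - c x) V" using inj by (auto simp: inj_on_def)
  have w: "w \<in> V" "a < k" "b < k" using branch_child_less u v by auto
  define la lb where "la = w @ a # replicate (Suc ?R) 0" and "lb = w @ b # replicate (Suc ?R) 0"
  have la: "la \<in> branch w a" "la \<notin> tball w (Suc ?R)" "la \<notin> branch w b"
    and lb: "lb \<in> branch w b" "lb \<notin> tball w (Suc ?R)" "lb \<notin> branch w a"
    using branch_leaf[OF w(1,2) hR] branch_leaf[OF w(1,3) hR] branch_disjoint ab
    unfolding la_def lb_def by blast+
  have c1: "cvx c (branch w a \<union> tball w (Suc ?R))" "cvx c (branch w b \<union> tball w (Suc ?R))"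
    and c2: "cvx c (branch w b \<union> tball w ?R)"
    using branch_cvx u v hR by auto
  have wb: "w \<in> tball w n" for n using w self_in_tball by blast
  have s: "c m < c lb" if "m \<in> tball w (Suc ?R)" for m
    using sides(1)[OF inj c1 branch_subset branch_subset tball_subset la(1,3,2) lb(1,3,2) wb that]
      lt unfolding la_def by auto
  have s': "c x < c m" if "x \<in> branch w a" "x \<notin> tball w (Suc ?R)" "m \<in> tball w (Suc ?R)" for x m
    using sides(1)[OF inj', of "branch w b" "tball w (Suc ?R)" "branch w a" lb x w m]
      c1 branch_subset tball_subset lb that wb s[OF wb] branch_disjoint ab
    by (simp add: cvx_uminus)
  show ?thesis
  proof (rule end_of_branch[OF u hr])
    fix y m assume y: "y \<in> branch w a \<inter> tball w (Suc ?R) - tball w ?R" and m: "m \<in> tball w ?R"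
    then have "- c m < - c y"
      using beyond[OF inj', of "branch w b \<union> tball w ?R" lb y m] s[of y] c2 lb
        branch_subset[of w b] tball_subset[of w ?R] branch_disjoint[OF ab, of y w] branch_subset[of w a]
      by (auto simp: cvx_uminus)
    then show "c y < c m" by simp
  qed (use s' in blast)
qed

lemma two_branches_top:
  assumes "lab c" "cons c u" "u \<in> branch w a" "cons c v" "v \<in> branch w b"
    "a \<noteq> b" "h = length w + 3 + r"
  shows "u = w @ [a]"
proof (cases "c (w @ a # replicate (Suc (Suc r)) 0) < c w")
  case True
  with two_branches_top_aux assms show ?thesis by blast
next
  case False
  then have "- c (w @ a # replicate (Suc (Suc r)) 0) < - c w"
    using leaf_label_neq[OF assms(1), of w a "Suc r"] branch_child_less[OF assms(3)] assms(7)
    by (simp del: replicate_Suc)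
  then show ?thesis
    using two_branches_top_aux[OF lab_uminus[OF assms(1)] iffD2[OF cons_uminus assms(2)] assms(3)
        iffD2[OF cons_uminus assms(4)] assms(5-7)] by blast
qed

subsection \<open>A consistent vertex and a consistent descendant\<close>

lemma card_level:
  assumes "w \<in> V" "a < k" "h = length w + 2 + R"
  shows "card (branch w a \<inter> tball w (Suc R) - tball w R) = k ^ R"
proof -
  have l: "length w + R < h" using assms by simp
  have "branch w a \<inter> tball w (Suc R) - tball w R
      = (\<lambda>y. w @ a # y) ` {y. set y \<subseteq> {..<k} \<and> length y = R}"
  proof (intro antisym subsetI)
    fix x assume x: "x \<in> branch w a \<inter> tball w (Suc R) - tball w R"
    then obtain y where y: "x = w @ a # y" by (auto simp: branch_def)
    with x have "length y = R" "set y \<subseteq> {..<k}" by (auto simp: tball_def append_in_V)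
    with y show "x \<in> (\<lambda>y. w @ a # y) ` {y. set y \<subseteq> {..<k} \<and> length y = R}" by auto
  qed (use assms(1,2) l in \<open>auto simp: branch_def tball_def append_in_V\<close>)
  then show ?thesis by (simp add: card_image inj_on_def card_lists_length_eq)
qed

lemma odd_card_binary_tball: "k = 2 \<Longrightarrow> n \<le> h \<Longrightarrow> odd (card (tball [] n))"
proof -
  assume "k = 2" "n \<le> h"
  have "tball [] n = {y. set y \<subseteq> {..<k} \<and> length y \<le> n}"
    using \<open>n \<le> h\<close> by (auto simp: tball_def kary_verts_def)
  then have "card (tball [] n) = (\<Sum>i\<le>n. 2 ^ i)" using \<open>k = 2\<close> by (simp add: card_lists_length_le)
  also have "\<dots> = 1 + (\<Sum>i<n. 2 * 2 ^ i)" by (simp add: sum.atMost_shift)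
  finally show ?thesis by (simp flip: sum_distrib_left)
qed

text \<open>Convexity pushes the sphere outside the branch of \<open>a\<close> to the right of
  \<open>w\<close>, and the two balance inequalities then bound its size by the part of the sphere
  inside the branch. This leaves only \<open>k = 2\<close>, with the inside part entirely to the
  left of \<open>w\<close>.\<close>

lemma chain_aux:
  assumes lab: "lab c" and w: "cons c w" and u: "cons c u" "u \<in> branch w a"
    and hr: "h = length w + 3 + r"
    and z: "z \<in> tball w (Suc (Suc r))" "z \<notin> tball w (Suc r)" "z \<notin> branch w a" "c w < c z"
  shows "k = 2 \<and> u = w @ [a]"
proof -
  define R A M N where "R = Suc r" and "A = branch w a" and "M = tball w (Suc R)" and "N = tball w R"
  have hR: "h = length w + 2 + R" using hr by (simp add: R_def)
  have inj: "inj_on c V" using lab by (simp add: lab_def)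
  have inj': "c x = c y \<longleftrightarrow> x = y" if "x \<in> V" "y \<in> V" for x y
    using inj_on_eq_iff[OF inj that] .
  have wV: "w \<in> V" "a < k" using branch_child_less u by auto
  have sub: "A \<subseteq> V" "M \<subseteq> V" "N \<subseteq> V" "N \<subseteq> M"
    by (auto simp: A_def M_def N_def branch_def tball_def)
  have fin: "finite M" "finite N" by (auto simp: M_def N_def finite_tball)
  have z: "z \<in> M" "z \<notin> N" "z \<notin> A" "c w < c z" using z by (auto simp: M_def N_def A_def R_def)
  have wM: "w \<in> N" "w \<in> M" using wV by (auto simp: M_def N_def self_in_tball)
  have wA: "w \<notin> A" by (auto simp: A_def branch_def)
  have cM: "cvx c M" "cvx c N" using tball_cvx[OF w] by (auto simp: M_def N_def)
  have cA: "cvx c (A \<union> M)" "cvx c (A \<union> N)"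
    using branch_cvx[OF u] hR by (auto simp: M_def N_def A_def)
  have l1: "c x < c m" if "x \<in> A" "x \<notin> M" "m \<in> M" for x m
  proof (rule ccontr)
    assume "\<not> c x < c m"
    then have "c m < c x" using inj'[of x m] that sub by fastforce
    moreover have "\<not> c z < c x" using cvxD[OF cA(2), of w x z] that z wM sub by blast
    then have "c x < c z" using inj'[of x z] that z sub by fastforce
    ultimately show False using cvxD[OF cM(1), of m z x] that z sub by blast
  qed
  define la where "la = w @ a # replicate (Suc R) 0"
  have la: "la \<in> A" "la \<notin> M"
    using branch_leaf[OF wV hR] by (auto simp: la_def A_def M_def simp del: replicate_Suc)
  \<comment> \<open>The sphere of radius \<open>Suc R\<close> around \<open>w\<close>, split into
    the parts outside and inside the branch of \<open>a\<close>.\<close>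
  define E D where "E = M - N - A" and "D = A \<inter> M - N"
  have l2: "c y < c x" if "x \<in> E" "y \<in> A \<union> N" for x y
    using beyond[OF inj cA(2), of la x y] that l1[of la x] la sub by (auto simp: E_def)
  let ?l = "\<lambda>X. {x \<in> X. c x < c w}" and ?r = "\<lambda>X. {x \<in> X. c w < c x}"
  \<comment> \<open>The two balances are used in opposite directions: \<open>z\<close> is an outer
    vertex on the right of the smaller ball, \<open>la\<close> one on the left of the larger
    ball.\<close>
  have bal2: "card (?l N) \<le> Suc (card (?r N))"
    using balance[OF lab w, of z R] z sub by (auto simp: N_def)
  have bal1: "card (?r M) \<le> Suc (card (?l M))"
    using balance[OF lab_uminus[OF lab] iffD2[OF cons_uminus w], of la "Suc R"] la l1[OF la wM(2)] sub
    by (auto simp: M_def)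
  have finD: "finite D" "finite E" using fin by (auto simp: D_def E_def)
  have "M = N \<union> D \<union> E" using sub by (auto simp: D_def E_def)
  then have eM: "?l M = ?l N \<union> ?l D" "?r M = ?r N \<union> ?r D \<union> E"
    using l2[OF _ UnI2[OF wM(1)]] by fastforce+
  have cl: "card (?l M) = card (?l N) + card (?l D)"
    unfolding eM using fin finD by (subst card_Un_disjoint) (auto simp: D_def)
  have cr: "card (?r M) = card (?r N) + card (?r D) + card E"
    unfolding eM using fin finD by (subst card_Un_disjoint; (subst card_Un_disjoint)?) (auto simp: D_def E_def)
  have "D = ?l D \<union> ?r D" using inj'[of _ w] wV wA sub by (force simp: D_def)
  then have "card D = card (?l D \<union> ?r D)" by simp
  also have "\<dots> = card (?l D) + card (?r D)" using finD by (subst card_Un_disjoint) auto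
  finally have cD: "card D = card (?l D) + card (?r D)" .
  have D: "card D = k ^ R" using card_level[OF wV hR] by (simp add: D_def A_def M_def N_def)
  \<comment> \<open>Chaining the two balances cancels the contribution of \<open>N\<close>; each
    contributes one unit of slack.\<close>
  have ineq: "card E + 2 * card (?r D) \<le> k ^ R + 2" using bal1 bal2 cl cr cD D by linarith
  have level_E: "branch w b \<inter> M - N \<subseteq> E" if "b \<noteq> a" for b
    using branch_disjoint[OF that] by (auto simp: E_def A_def)
  have k: "k = 2"
  proof (rule ccontr)
    assume "k \<noteq> 2"
    then have k3: "3 \<le> k" using k2 by simp
    obtain b where b: "b < k" "b \<noteq> a" using other_child by blast
    obtain d where d: "d < k" "d \<noteq> a" "d \<noteq> b" using third_child k3 by blast
    let ?B = "branch w b \<inter> M - N" and ?C = "branch w d \<inter> M - N"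
    have "card (?B \<union> ?C) \<le> card E" using level_E b d finD by (intro card_mono) auto
    moreover have "card (?B \<union> ?C) = card ?B + card ?C"
      using branch_disjoint d(3) fin by (intro card_Un_disjoint) blast+
    ultimately have "2 * k ^ R \<le> card E"
      using card_level[OF wV(1) b(1) hR] card_level[OF wV(1) d(1) hR] by (simp add: M_def N_def)
    moreover have "3 \<le> k ^ R" using k3 self_le_power[of k R] by (simp add: R_def del: power_Suc)
    ultimately show False using ineq by linarith
  qed
  obtain b where b: "b < k" "b \<noteq> a" using other_child by blast
  let ?B = "branch w b \<inter> M - N"
  have cB: "card ?B = k ^ R" using card_level[OF wV(1) b(1) hR] by (simp add: M_def N_def)
  have E_ge: "k ^ R \<le> card E"
    using card_mono[OF finD(2) level_E[OF b(2)]] cB by simp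
  have Dr: "?r D = {}"
  proof (rule ccontr)
    assume "?r D \<noteq> {}"
    then have "card (?r D) \<noteq> 0" using finD by simp
    then have eq: "card (?r D) = 1" "card E = k ^ R" using ineq E_ge by linarith+
    show False
    proof (cases "w = []")
      case True
      \<comment> \<open>With equality everywhere, the right side of \<open>M\<close> has exactly one
        vertex more than the left, so counting \<open>w\<close> makes \<open>card M\<close>
        even.\<close>
      have "card M = card (?l M \<union> ?r M \<union> {w})"
        using inj'[of _ w] wV wM sub by (intro arg_cong[where f = card]) force
      also have "\<dots> = card (?l M \<union> ?r M) + 1" using fin by (subst card_Un_disjoint) auto
      also have "card (?l M \<union> ?r M) = card (?l M) + card (?r M)"
        using fin by (subst card_Un_disjoint) auto
      also have "card (?r M) = card (?l M) + 1" using bal1 bal2 cl cr cD D eq by linarith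
      finally have "even (card M)" by simp
      then show False using odd_card_binary_tball[OF k, of "Suc R"] hR True by (simp add: M_def)
    next
      case False
      \<comment> \<open>Away from the root, \<open>E\<close> has an additional vertex reached
        through the parent of \<open>w\<close>.\<close>
      obtain y where y: "y \<in> M" "y \<notin> N" "y \<notin> A" "y \<notin> branch w b"
        using far_vertex[OF wV(1) hR, of a b] False by (auto simp: M_def N_def A_def)
      have "card (insert y ?B) \<le> card E"
        using y level_E[OF b(2)] finD by (intro card_mono) (auto simp: E_def)
      moreover have "card (insert y ?B) = Suc (card ?B)" using y fin by (subst card_insert_disjoint) auto
      ultimately show False using eq cB by simp
    qed
  qed
  have "u = w @ [a]"
  proof (rule end_of_branch[OF u hr])
    fix x y assume "x \<in> branch w a - tball w (Suc (Suc r))"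
      "y \<in> branch w a \<inter> tball w (Suc (Suc r)) - tball w (Suc r)"
    then show "c x < c y" using l1[of x y] by (auto simp: A_def M_def R_def)
  next
    fix y m assume "y \<in> branch w a \<inter> tball w (Suc (Suc r)) - tball w (Suc r)" "m \<in> tball w (Suc r)"
    then have y: "y \<in> D" and m: "m \<in> N" by (auto simp: D_def A_def M_def N_def R_def)
    have "y \<noteq> w" "y \<noteq> m" using y m wA by (auto simp: D_def)
    then have ne: "c y \<noteq> c w" "c y \<noteq> c m" using inj'[of y w] inj'[of y m] y m wV sub by (auto simp: D_def)
    then have "c y < c w" using Dr y by force
    then show "c y < c m"
      using cvxD[OF cM(2), of m w y] y m wM ne sub by (force simp: D_def)
  qed
  with k show ?thesis by blast
qed

lemma chain:
  assumes lab: "lab c" and w: "cons c w" and u: "cons c u" "u \<in> branch w a"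
    and hr: "h = length w + 3 + r"
  shows "k = 2 \<and> u = w @ [a]"
proof -
  have hR: "h = length w + 2 + Suc r" using hr by simp
  have wV: "w \<in> V" using branch_child_less u by auto
  obtain b where b: "b < k" "b \<noteq> a" using other_child by blast
  let ?E = "branch w b \<inter> tball w (Suc (Suc r)) - tball w (Suc r)"
  have "card ?E \<noteq> 0" using card_level[OF wV b(1) hR] k2 by simp
  then obtain z where "z \<in> ?E" by (metis card.empty ex_in_conv)
  then have z: "z \<in> tball w (Suc (Suc r))" "z \<notin> tball w (Suc r)" "z \<notin> branch w a"
    using branch_disjoint[OF b(2)] by auto
  have "z \<noteq> w" using z wV self_in_tball by blast
  then have "c z \<noteq> c w" using lab z wV tball_subset by (auto simp: lab_def dest: inj_onD)
  then consider "c w < c z" | "- c w < - c z" by linarith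
  then show ?thesis
  proof cases
    case 1
    then show ?thesis using chain_aux[OF assms z] by blast
  next
    case 2
    then show ?thesis
      using chain_aux[OF lab_uminus[OF lab] iffD2[OF cons_uminus w] iffD2[OF cons_uminus u(1)] u(2) hr z]
      by blast
  qed
qed

section \<open>Consistent leaves and their parents\<close>

text \<open>The unit ball of a leaf consists of the leaf and its parent; its convexity makes their
  labels adjacent.\<close>

lemma leaf_between:
  assumes "cons c (p @ [i])" "length p + 1 = h" "x \<in> V" "x \<noteq> p @ [i]" "x \<noteq> p"
  shows "\<not> (c (p @ [i]) < c x \<and> c x < c p)" "\<not> (c p < c x \<and> c x < c (p @ [i]))"
proof -
  have p: "p @ [i] \<in> V" "p \<in> V" using assms(1) kary_verts_append[of p "[i]"] by (auto simp: cons_def)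
  have "tball (p @ [i]) 1 = {p @ [i], p}"
  proof (rule antisym)
    show "tball (p @ [i]) 1 \<subseteq> {p @ [i], p}"
    proof
      fix y assume y: "y \<in> tball (p @ [i]) 1"
      show "y \<in> {p @ [i], p}"
      proof (cases "\<exists>t. y = p @ i # t")
        case True
        then show ?thesis using y assms(2) by (auto simp: tball_def kary_verts_def)
      next
        case False
        then have "tdist p y = 0" using tdist_off_branch[OF False, of "[]"] y by (auto simp: tball_def)
        then show ?thesis by (simp add: tdist_eq_0)
      qed
    qed
  qed (use p in \<open>auto simp: tball_def\<close>)
  then have "cvx c {p @ [i], p}" using tball_cvx[OF assms(1), of 1] by simp
  then show "\<not> (c (p @ [i]) < c x \<and> c x < c p)" "\<not> (c p < c x \<and> c x < c (p @ [i]))"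
    using cvxD[of c "{p @ [i], p}" _ _ x] assms(3-) by blast+
qed

lemma sibling_leaves:
  assumes lab: "lab c" and i: "cons c (p @ [i])" and j: "cons c (p @ [j])" and ij: "i \<noteq> j"
    and p: "length p + 1 = h"
  shows "c (p @ [i]) < c p \<and> c p < c (p @ [j]) \<or> c (p @ [j]) < c p \<and> c p < c (p @ [i])"
proof -
  have V: "p @ [i] \<in> V" "p @ [j] \<in> V" "p \<in> V"
    using i j kary_verts_append[of p "[i]"] by (auto simp: cons_def)
  have "c (p @ [i]) \<noteq> c p" "c (p @ [j]) \<noteq> c p" "c (p @ [i]) \<noteq> c (p @ [j])"
    using lab V ij by (auto simp: lab_def dest: inj_onD)
  then show ?thesis
    using leaf_between[OF i p V(2)] leaf_between[OF j p V(1)] ij by auto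
qed

subsection \<open>The upper bound\<close>

lemma cvx_Int: "cvx c A \<Longrightarrow> cvx c B \<Longrightarrow> cvx c (A \<inter> B)"
  unfolding cvx_def by blast

lemma two_leaves:
  assumes lab: "lab c" and p: "length p + 1 = h"
  shows "\<exists>y z. {u. cons c u \<and> (\<exists>i. u = p @ [i])} \<subseteq> {y, z}"
proof (rule ccontr)
  assume *: "\<nexists>y z. {u. cons c u \<and> (\<exists>i. u = p @ [i])} \<subseteq> {y, z}"
  then obtain i where i: "cons c (p @ [i])" by blast
  with * obtain j where j: "cons c (p @ [j])" "j \<noteq> i" by blast
  with * i obtain l where l: "cons c (p @ [l])" "l \<noteq> i" "l \<noteq> j" by blast
  show False
    using sibling_leaves[OF lab i j(1) _ p] sibling_leaves[OF lab i l(1) _ p]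
      sibling_leaves[OF lab j(1) l(1) _ p] j l by linarith
qed

text \<open>Two consistent leaves below \<open>w @ [a]\<close> would enclose its label on both
  sides. One of them would then separate it from the label of \<open>w\<close>, although both
  vertices lie in the convex unit ball around \<open>w\<close>, which has no such leaf.\<close>

lemma one_leaf:
  assumes lab: "lab c" and hw: "h = length w + 2" and cvx: "cvx c (tball w 1)"
  shows "\<exists>y. {u. cons c u} \<inter> branch w a \<subseteq> {w @ [a], y}"
proof (rule ccontr)
  assume *: "\<nexists>y. {u. cons c u} \<inter> branch w a \<subseteq> {w @ [a], y}"
  define p where "p = w @ [a]"
  have leaf: "\<exists>i. u = p @ [i]" if u: "cons c u" "u \<in> branch w a" "u \<noteq> p" for u
  proof -
    obtain t where t: "u = w @ a # t" "u \<in> V" using u by (auto simp: branch_def)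
    then have "length t \<le> 1" "t \<noteq> []" using hw u by (auto simp: kary_verts_def p_def)
    then obtain i where "t = [i]" by (cases t) auto
    then show ?thesis using t by (simp add: p_def)
  qed
  from * obtain u where u: "cons c u" "u \<in> branch w a" "u \<noteq> p" by (auto simp: p_def)
  with * obtain v where v: "cons c v" "v \<in> branch w a" "v \<noteq> p" "v \<noteq> u" by (auto simp: p_def)
  obtain i j where ij: "u = p @ [i]" "v = p @ [j]" using leaf u v by blast
  have V: "p @ [i] \<in> V" "p @ [j] \<in> V" "p \<in> V" "w \<in> V"
    using u v ij kary_verts_append[of p "[i]"] kary_verts_append[of w "[a]"]
    by (auto simp: cons_def p_def)
  have M: "w \<in> tball w 1" "p \<in> tball w 1" "p @ [i] \<notin> tball w 1" "p @ [j] \<notin> tball w 1"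
    using V by (auto simp: tball_def p_def)
  have ne: "c w \<noteq> c p" "c w \<noteq> c (p @ [i])" "c w \<noteq> c (p @ [j])"
    using lab V by (auto simp: lab_def p_def dest: inj_onD)
  have hp: "length p + 1 = h" using hw by (simp add: p_def)
  have "w \<noteq> p" "w \<noteq> p @ [i]" "w \<noteq> p @ [j]" by (auto simp: p_def)
  then show False
    using sibling_leaves[OF lab u(1)[unfolded ij] v(1)[unfolded ij] _ hp]
      leaf_between[OF u(1)[unfolded ij] hp V(4)] leaf_between[OF v(1)[unfolded ij] hp V(4)]
      cvxD[OF cvx M(1) M(2) V(1)] cvxD[OF cvx M(2) M(1) V(1)]
      cvxD[OF cvx M(1) M(2) V(2)] cvxD[OF cvx M(2) M(1) V(2)] v(4) ij M ne
    by (metis linorder_neqE_linordered_idom less_trans)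
qed

text \<open>Since the branches are disjoint, the ball is the intersection of the two convex unions
  given by \<open>branch_cvx\<close>; \<open>w\<close> itself need not be consistent.\<close>

lemma cvx_centre_ball:
  assumes "cons c u" "u \<in> branch w a" "cons c v" "v \<in> branch w b" "a \<noteq> b" "h \<le> length w + 2 + R"
  shows "cvx c (tball w R)"
proof -
  have "tball w R = (branch w a \<union> tball w R) \<inter> (branch w b \<union> tball w R)"
    using branch_disjoint[OF assms(5)] by blast
  then show ?thesis
    using cvx_Int branch_cvx[OF assms(1,2,6)] branch_cvx[OF assms(3,4,6)] by metis
qed

text \<open>The height of the subtree below the deepest common ancestor \<open>w\<close> decides: 1,
  2 or at least 3. In the last two cases, either \<open>w\<close> is consistent with all others in
  one branch, or two branches contain consistent vertices.\<close>

lemma consistent_bound: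
  assumes lab: "lab c"
  shows "(\<exists>x y z. {u. cons c u} \<subseteq> {x, y, z}) \<or> k = 2 \<and> h = 2 \<and> card {u. cons c u} \<le> 5"
proof -
  define S where "S = {u. cons c u}"
  let ?P = "\<lambda>w. w \<in> V \<and> (\<forall>u\<in>S. \<exists>t. u = w @ t)"
  have "?P []" by (auto simp: kary_verts_def)
  moreover have "\<forall>w. ?P w \<longrightarrow> length w < Suc h" by (auto simp: kary_verts_def)
  ultimately obtain w where w: "w \<in> V" "\<And>u. u \<in> S \<Longrightarrow> \<exists>t. u = w @ t"
    and max: "\<And>w'. ?P w' \<Longrightarrow> length w' \<le> length w"
    using ex_has_greatest_nat[of ?P "[]" length "Suc h"] by auto
  have SV: "S \<subseteq> V" by (auto simp: S_def cons_def)
  have below: "\<exists>a. u \<in> branch w a" if u: "u \<in> S" "u \<noteq> w" for u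
  proof -
    obtain t where "u = w @ t" using w(2)[OF u(1)] by blast
    with u SV show ?thesis by (cases t) (auto simp: branch_def)
  qed
  show ?thesis
  proof (cases "S \<subseteq> {w}")
    case True
    then show ?thesis unfolding S_def by blast
  next
    case False
    then obtain u a where u: "u \<in> S" "u \<in> branch w a" using below by blast
    then have uc: "cons c u" by (simp add: S_def)
    have a: "a < k" "length w < h" using u by (auto simp: branch_def append_in_V)
    \<comment> \<open>Otherwise \<open>w @ [a]\<close> would be a deeper common ancestor.\<close>
    have "\<exists>v\<in>S. v \<notin> branch w a"
    proof (rule ccontr)
      assume "\<not> ?thesis"
      then have "\<And>v. v \<in> S \<Longrightarrow> \<exists>t. v = (w @ [a]) @ t" by (auto simp: branch_def)
      then have "?P (w @ [a])" using w a by (auto simp: append_in_V)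
      from max[OF this] show False by simp
    qed
    then obtain v where v: "v \<in> S" "v \<notin> branch w a" by blast
    then have vc: "cons c v" by (simp add: S_def)
    have "h = length w + 1 \<or> h = length w + 2 \<or> (\<exists>r. h = length w + 3 + r)"
      using a(2) by presburger
    then consider (1) "h = length w + 1" | (2) "h = length w + 2" | (3) r where "h = length w + 3 + r"
      by blast
    then show ?thesis
    proof cases
      case 1
      have "u = w \<or> (\<exists>i. u = w @ [i])" if u: "u \<in> S" for u
      proof -
        obtain t where t: "u = w @ t" using w(2)[OF u] by blast
        then have "length t \<le> 1" using u SV 1 by (auto simp: kary_verts_def)
        then show ?thesis using t by (cases t) auto
      qed
      moreover obtain y z where "{u. cons c u \<and> (\<exists>i. u = w @ [i])} \<subseteq> {y, z}"
        using two_leaves[OF lab, of w] 1 by auto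
      ultimately have "S \<subseteq> {w, y, z}" by (auto simp: S_def)
      then show ?thesis unfolding S_def by blast
    next
      case 2
      then have hR: "h = length w + 2 + 0" "h \<le> length w + 2 + 1" by simp_all
      show ?thesis
      proof (cases "S \<subseteq> insert w (branch w a)")
        case True
        then have "cons c w" using v vc by auto
        from one_leaf[OF lab 2 tball_cvx[OF this]] obtain y
          where "{u. cons c u} \<inter> branch w a \<subseteq> {w @ [a], y}" by blast
        with True have "S \<subseteq> {w, w @ [a], y}" unfolding S_def by blast
        then show ?thesis unfolding S_def by blast
      next
        case False
        then obtain x b where x: "x \<in> S" "x \<in> branch w b" "b \<noteq> a" using below by blast
        then have xc: "cons c x" by (simp add: S_def)
        have b: "b < k" using branch_child_less x by blast
        have "\<not> (3 \<le> k \<or> w \<noteq> [])"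
          using two_branches_contra[OF lab uc u(2) xc x(2) x(3)[symmetric] hR(1)] by blast
        then have kw: "k = 2" "w = []" using k2 by auto
        \<comment> \<open>Taken with radius 1, as \<open>one_leaf\<close> needs, although radius 0
          would already satisfy the height bound.\<close>
        note cvx = cvx_centre_ball[OF uc u(2) xc x(2) x(3)[symmetric] hR(2)]
        obtain y z where yz: "S \<inter> branch w a \<subseteq> {w @ [a], y}" "S \<inter> branch w b \<subseteq> {w @ [b], z}"
          using one_leaf[OF lab 2 cvx] unfolding S_def by metis
        have "S \<subseteq> {w, w @ [a], y, w @ [b], z}"
        proof
          fix s assume s: "s \<in> S"
          show "s \<in> {w, w @ [a], y, w @ [b], z}"
          proof (cases "s = w")
            case False
            then obtain d where d: "s \<in> branch w d" using below s by blast
            then have "d = a \<or> d = b" using branch_child_less[OF d] a b x(3) kw by linarith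
            then show ?thesis using d s yz by blast
          qed simp
        qed
        then have "card S \<le> card {w, w @ [a], y, w @ [b], z}" by (intro card_mono) auto
        also have "\<dots> \<le> 5" by (simp add: card_insert_if)
        finally show ?thesis using kw 2 by (simp add: S_def)
      qed
    next
      case (3 r)
      then have hR: "h = length w + 2 + Suc r" by simp
      show ?thesis
      proof (cases "S \<subseteq> insert w (branch w a)")
        case True
        then have "cons c w" using v vc by auto
        then have "s = w @ [a]" if "s \<in> S" "s \<in> branch w a" for s
          using chain[OF lab _ _ that(2) 3] that by (simp add: S_def)
        then have "S \<subseteq> {w, w @ [a], w}" using True by blast
        then show ?thesis unfolding S_def by blast
      next
        case False
        then obtain x b where x: "x \<in> S" "x \<in> branch w b" "b \<noteq> a" using below by blast
        then have xc: "cons c x" by (simp add: S_def)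
        have b: "b < k" using branch_child_less x by blast
        have "\<not> 3 \<le> k"
          using two_branches_contra[OF lab uc u(2) xc x(2) x(3)[symmetric] hR] by blast
        then have kw: "k = 2" using k2 by simp
        have "S \<subseteq> {w, w @ [a], w @ [b]}"
        proof
          fix s assume s: "s \<in> S"
          then have sc: "cons c s" by (simp add: S_def)
          show "s \<in> {w, w @ [a], w @ [b]}"
          proof (cases "s = w")
            case False
            then obtain d where d: "s \<in> branch w d" using below s by blast
            then have "d = a \<or> d = b" using branch_child_less[OF d] a b x(3) kw by linarith
            then show ?thesis
              using two_branches_top[OF lab sc _ xc x(2) x(3)[symmetric] 3]
                two_branches_top[OF lab sc _ uc u(2) x(3) 3] d by blast
          qed simp
        qed
        then show ?thesis unfolding S_def by blast
      qed
    qed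
  qed
qed

end

subsection \<open>Labelings attaining the bound\<close>

text \<open>Elements are added in nondecreasing order of \<open>f\<close>, each receiving the next
  label; ties are broken arbitrarily.\<close>

lemma monotone_labeling:
  fixes f :: "'a \<Rightarrow> nat"
  assumes "finite A"
  shows "\<exists>c. bij_betw c A {1..card A} \<and> (\<forall>x\<in>A. \<forall>y\<in>A. f x < f y \<longrightarrow> c x < c y)"
  using assms
proof (induction rule: finite_ranking_induct[where f = f])
  case empty
  then show ?case by (simp add: bij_betw_def)
next
  case (insert x S)
  show ?case
  proof (cases "x \<in> S")
    case True
    then show ?thesis using insert by (simp add: insert_absorb)
  next
    case False
    obtain c where c: "bij_betw c S {1..card S}" "\<forall>x\<in>S. \<forall>y\<in>S. f x < f y \<longrightarrow> c x < c y"
      using insert by blast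
    let ?c = "c(x := Suc (card S))"
    have "bij_betw ?c S {1..card S}"
      using c(1) False by (metis bij_betw_cong fun_upd_other)
    then have "bij_betw ?c (insert x S) (insert (Suc (card S)) {1..card S})"
      using False notIn_Un_bij_betw[of x S ?c "{1..card S}"] by simp
    moreover have "insert (Suc (card S)) {1..card S} = {1..card (insert x S)}"
      using False insert(1) by auto
    moreover have "\<forall>y\<in>insert x S. \<forall>z\<in>insert x S. f y < f z \<longrightarrow> ?c y < ?c z"
      using c insert(2) bij_betwE[OF c(1)] False by (auto simp: less_Suc_eq_le leD)
    ultimately show ?thesis by metis
  qed
qed

context kary begin

text \<open>A leaf, its parent and a sibling get the labels 1, 2, 3; the other vertices follow in order of
  their distance from the parent.\<close>

lemma three_consistent:
  "\<exists>c. bij_betw c V {1..card V} \<and> 3 \<le> card {u. cons (\<lambda>x. int (c x)) u}"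
proof -
  define p where "p = replicate (h - 1) (0::nat)"
  define u v where "u = p @ [0]" and "v = p @ [1]"
  have pV: "p \<in> V" "u \<in> V" "v \<in> V" and lp: "length p + 1 = h"
    using h1 k2 by (auto simp: p_def u_def v_def kary_verts_def set_replicate_conv_if)
  have neq: "u \<noteq> p" "v \<noteq> p" "u \<noteq> v" by (auto simp: u_def v_def)
  \<comment> \<open>The ranks 0, 1, 2 are reserved for the three chosen vertices; the offset 3 keeps
    all others above them.\<close>
  define f where "f x = (if x = u then 0 else if x = p then 1 else if x = v then 2 else 3 + tdist p x)" for x
  obtain c where c: "bij_betw c V {1..card V}" and mono: "\<And>x y. x \<in> V \<Longrightarrow> y \<in> V \<Longrightarrow> f x < f y \<Longrightarrow> c x < c y"
    using monotone_labeling[OF finite_kary_verts, of k h f] by blast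
  have dleaf: "tdist (p @ [i]) x = Suc (tdist p x)" if x: "x \<in> V" "x \<noteq> p @ [i]" for x i
  proof -
    have "\<nexists>y. x = p @ i # y" using x lp by (auto simp: kary_verts_def)
    from tdist_off_branch[OF this, of "[]"] show ?thesis by simp
  qed
  have du: "tdist u x = (if x = u then 0 else Suc (tdist p x))" if "x \<in> V" for x
    using dleaf[OF that, of 0] by (simp add: u_def)
  have dv: "tdist v x = (if x = v then 0 else Suc (tdist p x))" if "x \<in> V" for x
    using dleaf[OF that, of 1] by (simp add: v_def)
  have dp: "tdist p u = 1" "tdist p v = 1" "tdist p p = 0" by (simp_all add: u_def v_def)
  have dp0: "0 < tdist p x" if "x \<noteq> p" for x using tdist_eq_0[of p x] that by simp
  have lt: "c u < c p" "c p < c v" using mono pV neq by (auto simp: f_def)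
  have oth: "c v < c y" if "y \<in> V" "y \<notin> {u, p, v}" for y
    using mono[of v y] pV that neq by (auto simp: f_def)
  have F: "c x < c y" if "x \<in> V" "y \<in> V" "x \<notin> {u, p, v}" "y \<notin> {u, p, v}" "tdist p x < tdist p y" for x y
    using mono[of x y] that by (auto simp: f_def)
  have consec: "c t = Suc (c s)" if st: "s \<in> V" "t \<in> V" "c s < c t"
    and b: "\<And>x. x \<in> V \<Longrightarrow> c s < c x \<Longrightarrow> c t \<le> c x" for s t
  proof -
    have "c s \<in> {1..card V}" "c t \<in> {1..card V}" using bij_betwE[OF c] st by auto
    then have "Suc (c s) \<in> c ` V" using st(3) bij_betw_imp_surj_on[OF c] by auto
    then obtain x where "x \<in> V" "c x = Suc (c s)" by auto
    then show ?thesis using b[of x] st(3) by simp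
  qed
  have cp: "c p = Suc (c u)"
  proof (rule consec)
    show "c p \<le> c x" if "x \<in> V" "c u < c x" for x
      using oth[of x] that lt by (cases "x \<in> {u, p, v}") auto
  qed (use pV lt in auto)
  have cv: "c v = Suc (c p)"
  proof (rule consec)
    show "c v \<le> c x" if "x \<in> V" "c p < c x" for x
      using oth[of x] that lt by (cases "x \<in> {u, p, v}") auto
  qed (use pV lt in auto)
  \<comment> \<open>A vertex at distance 2 from \<open>p\<close> exists only if \<open>p\<close> has
    a parent, and the parent takes a label between those of \<open>v\<close> and
    \<open>y\<close>.\<close>
  have far: "Suc (Suc (c v)) \<le> c y" if y: "y \<in> V" "2 \<le> tdist p y" for y
  proof -
    have "p \<noteq> []" using y lp by (auto simp: kary_verts_def)
    then obtain g i where g: "p = g @ [i]" by (metis rev_exhaust)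
    have "g \<in> V" "g \<notin> {u, p, v}" "tdist p g = 1"
      using g pV kary_verts_append[of g "[i]"] by (auto simp: u_def v_def)
    moreover from this have "c v < c g" using oth by blast
    moreover have "y \<notin> {u, p, v}" using y dp by auto
    ultimately show ?thesis using F[of g y] y by fastforce
  qed
  have "cons (\<lambda>x. int (c x)) p"
    unfolding cons_def
  proof (intro conjI ballI impI)
    fix x y assume xy: "x \<in> V" "y \<in> V" "tdist p x < tdist p y"
    show "\<bar>int (c p) - int (c x)\<bar> \<le> \<bar>int (c p) - int (c y)\<bar>"
    proof (cases "x = p")
      case False
      then have "y \<notin> {u, p, v}" using xy dp dp0[of x] by auto
      then have "c v < c y" "x \<notin> {u, p, v} \<Longrightarrow> c v < c x \<and> c x < c y" using oth F xy by auto
      then show ?thesis using lt cp cv False by (cases "x \<in> {u, p, v}") auto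
    qed simp
  qed (rule pV)
  moreover have "cons (\<lambda>x. int (c x)) u"
    unfolding cons_def
  proof (intro conjI ballI impI)
    fix x y assume xy: "x \<in> V" "y \<in> V" "tdist u x < tdist u y"
    show "\<bar>int (c u) - int (c x)\<bar> \<le> \<bar>int (c u) - int (c y)\<bar>"
    proof (cases "x = u")
      case False
      then have d: "tdist p x < tdist p y" "y \<noteq> u" using xy du by (auto split: if_splits)
      show ?thesis
      proof (cases "y = v")
        case True
        then have "x = p" using d dp dp0[of x] by auto
        then show ?thesis using True lt by simp
      next
        case False
        then have "y \<notin> {u, p, v}" using d dp by auto
        then have "c v < c y" "x \<notin> {u, p, v} \<Longrightarrow> c v < c x \<and> c x < c y" using oth F xy d by auto
        then show ?thesis using lt cp cv \<open>x \<noteq> u\<close> by (cases "x \<in> {u, p, v}") auto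
      qed
    qed simp
  qed (rule pV)
  moreover have "cons (\<lambda>x. int (c x)) v"
    unfolding cons_def
  proof (intro conjI ballI impI)
    fix x y assume xy: "x \<in> V" "y \<in> V" "tdist v x < tdist v y"
    show "\<bar>int (c v) - int (c x)\<bar> \<le> \<bar>int (c v) - int (c y)\<bar>"
    proof (cases "x = v")
      case False
      then have d: "tdist p x < tdist p y" "y \<noteq> v" using xy dv by (auto split: if_splits)
      show ?thesis
      proof (cases "y = u")
        case True
        then have "x = p" using d dp dp0[of x] by auto
        then show ?thesis using True lt cp cv by simp
      next
        case False
        then have y: "y \<notin> {u, p, v}" using d dp by auto
        then have "c v < c y" "x \<notin> {u, p, v} \<Longrightarrow> c v < c x \<and> c x < c y" using oth F xy d by auto
        \<comment> \<open>The sibling \<open>u\<close> differs from \<open>v\<close> by 2 in label,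
          so a vertex \<open>y\<close> farther from \<open>v\<close> must differ by at least as
          much.\<close>
        moreover have "Suc (Suc (c v)) \<le> c y" if "x = u" using far[of y] xy d dp that by simp
        ultimately show ?thesis using lt cp cv \<open>x \<noteq> v\<close> by (cases "x \<in> {u, p, v}") auto
      qed
    qed simp
  qed (rule pV)
  ultimately have "card {u, p, v} \<le> card {u. cons (\<lambda>x. int (c x)) u}"
    by (intro card_mono finite_subset[OF _ finite_kary_verts[of k h]]) (auto simp: cons_def)
  then show ?thesis using c neq by auto
qed

end

section \<open>The exceptional binary tree of height two\<close>

lemma kary_verts_2_2:
  "kary_verts 2 2 = set [[0,1], [0,0], [0], [], [1], [1,0], [1,1]]"
proof (intro antisym subsetI)
  fix xs assume "xs \<in> kary_verts 2 2"
  then have "length xs \<le> 2" "set xs \<subseteq> {0,1}" by (auto simp: kary_verts_def)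
  then show "xs \<in> set [[0,1], [0,0], [0], [], [1], [1,0], [1,1]]"
    by (cases xs; cases "tl xs"; cases "tl (tl xs)") auto
qed (auto simp: kary_verts_def)

lemma five_consistent:
  "\<exists>c. bij_betw c (kary_verts 2 2) {1..card (kary_verts 2 2)} \<and>
    5 \<le> card {u. kary.cons 2 2 (\<lambda>x. int (c x)) u}"
proof -
  interpret kary 2 2 by unfold_locales auto
  \<comment> \<open>The labels are symmetric about the root, which has label 4. All vertices except
    the two extreme leaves are consistent.\<close>
  define c :: "nat list \<Rightarrow> nat" where
    "c = (\<lambda>_. 0)([0,1] := 1, [0,0] := 2, [0] := 3, [] := 4, [1] := 5, [1,0] := 6, [1,1] := 7)"
  have card: "card V = 7" by (simp add: kary_verts_2_2)
  have "{1..7::nat} = {1,2,3,4,5,6,7}" by auto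
  then have bij: "bij_betw c V {1..card V}"
    unfolding bij_betw_def card by (simp add: kary_verts_2_2 c_def)
  have "{[0,0], [0], [], [1], [1,0]} \<subseteq> {u. cons (\<lambda>x. int (c x)) u}"
    by (simp add: cons_def kary_verts_2_2 c_def)
  then have "card {[0,0], [0], [], [1], [1,0::nat]} \<le> card {u. cons (\<lambda>x. int (c x)) u}"
    by (intro card_mono finite_subset[OF _ finite_kary_verts[of 2 2]]) (auto simp: cons_def)
  then show ?thesis using bij by auto
qed

section \<open>Combining the bounds\<close>

theorem theorem4p2:
  fixes k h :: nat
  assumes "k \<ge> 2" and "h \<ge> 1"
  shows "pair_graph.ldc (kary_tree k h) = (if k = 2 \<and> h = 2 then 5 else 3)"
proof -
  interpret T: pair_graph "kary_tree k h" by (rule pair_graph_kary_tree)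
  interpret kary k h using assms by unfold_locales
  have verts: "pverts (kary_tree k h) = V" by (simp add: kary_tree_def)
  have S: "T.consistent_set c = {u. cons (\<lambda>x. int (c x)) u}" for c
    by (auto simp: T.consistent_set_def T.consistent_def cons_def T.label_diff_def verts gdist_kary_tree)
  have lab: "lab (\<lambda>x. int (c x))" if "T.labeling c" for c
  proof -
    have b: "bij_betw c V {1..card V}" using that by (simp add: T.labeling_def verts)
    then have "(\<lambda>x. int (c x)) ` V = {int 1..int (card V)}"
      by (metis bij_betw_imp_surj_on image_image image_int_atLeastAtMost)
    then show ?thesis using bij_betw_imp_inj_on[OF b] by (auto simp: lab_def inj_on_def)
  qed
  let ?n = "if k = 2 \<and> h = 2 then 5 else 3 :: nat"
  have upper: "card (T.consistent_set c) \<le> ?n" if "T.labeling c" for c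
  proof -
    have "card {u. cons (\<lambda>x. int (c x)) u} \<le> 3"
      if "{u. cons (\<lambda>x. int (c x)) u} \<subseteq> {x, y, z}" for x y z
      using card_mono[OF _ that] by (simp add: card_insert_if split: if_splits)
    then show ?thesis using consistent_bound[OF lab[OF that]] unfolding S by fastforce
  qed
  have "\<exists>c. T.labeling c \<and> ?n \<le> card (T.consistent_set c)"
    using three_consistent five_consistent unfolding S T.labeling_def verts by auto
  \<comment> \<open>The witness is only known to reach \<open>?n\<close>; \<open>upper\<close> turns
    this into equality.\<close>
  then obtain c where c: "T.labeling c" "?n \<le> card (T.consistent_set c)" by blast
  show ?thesis unfolding T.ldc_def
  proof (rule Max_eqI[OF T.ldc_max_well_defined(1)])
    show "?n \<in> {card (T.consistent_set c) | c. T.labeling c}"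
      using c upper[OF c(1)] by (auto intro!: exI[of _ c])
  qed (use upper in auto)
qed

end
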